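(* The congruence $\sim$ on the free monoid $X^*$ is generated by the relations \[ x_i x_j \sim x_{j+1} x_i, \] for all pairs of non-negative integers $i$ and $j$ with $i<j$. In other words, $X^*/{\sim}$ is equal to Thompson's monoid $P_2$, given by the monoid presentation \[ P_2=\mathrm{Mon}\langle\, x_0,x_1,x_2,\dots \mid x_i x_j = x_{j+1}x_i, \text{ for } i<j \,\rangle . \]
   Context: $\mathbb N=\{0,1,2,\dots\}$, $\mathbb N^+=\{1,2,\dots\}$, $X=\{x_0,x_1,x_2,\dots\}$, and $X^*$ is the free monoid on $X$. Linearized forests. A labeled binary rooted forest is a left-to-right sequence of finite planar rooted binary trees (every interior vertex has a left and a right child), with roots labeled $0,1,2,\dots$ from left to right, all but finitely many of which are trivial (a single vertex, which is both root and leaf); the leaves of the whole forest are labeled $0,1,2,\dots$ from left to right. An interior vertex together with its two children is called a caret. A linearized forest with $n$ carets is such a forest together with a bijective labeling of its $n$ interior vertices by $1,\dots,n$ such that the labels decrease along every path from a root to a leaf. $T^*$ is the set of all linearized forests. The map $\tau:X^*\to T^*$. The forest $\tau(x_{i_1}x_{i_2}\cdots x_{i_n})$ is built in $n$ steps starting from the trivial forest (all trees trivial, root labels equal to leaf labels). In step $j$ add a caret, labeled $j$, whose left child is the current root labeled $i_j$ and whose right child is the current root labeled $i_j+1$. The new interior vertex becomes the root labeled $i_j$, the old roots $i_j$ and $i_j+1$ are no longer roots, and all old root labels $\ge i_j+2$ decrease by 1. Leaf labels never change. This map is a bijection. The congruence $\sim$. For a linearized forest $t$, let $\widetilde t$ be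 the forest obtained by deleting the labels on all interior vertices. For $u,v\in X^*$, put $u\sim v$ if and only if $\widetilde{\tau(u)}=\widetilde{\tau(v)}$. This is a monoid congruence on $X^*$. *)

theory Defs
  imports "HOL-Library.Tree" "HOL-Algebra.Group"
begin

text \<open>
  The free monoid on generators indexed by \<open>'a\<close> is the type \<open>'a list\<close>, with append
  and the empty word. In particular the generator \<open>x\<^sub>i\<close> is the one-letter word \<open>[i :: nat]\<close>.
\<close>

definition monoid_congruence :: "('a list \<times> 'a list) set \<Rightarrow> bool" where
  "monoid_congruence R \<longleftrightarrow> equiv UNIV R \<and>
     (\<forall>u u' v v'. (u, u') \<in> R \<longrightarrow> (v, v') \<in> R \<longrightarrow> (u @ v, u' @ v') \<in> R)"

definition generated_congruence :: "('a list \<times> 'a list) set \<Rightarrow> ('a list \<times> 'a list) set" where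
  "generated_congruence R = \<Inter> {S. monoid_congruence S \<and> R \<subseteq> S}"

lemma monoid_congruence_generated_congruence: "monoid_congruence (generated_congruence R)"
proof -
  let ?C = "{S. monoid_congruence S \<and> R \<subseteq> S}"
  have eq: "refl S" "sym S" "trans S" if "S \<in> ?C" for S
    using that by (auto simp: monoid_congruence_def equiv_def)
  have app: "(u @ v, u' @ v') \<in> S" if "S \<in> ?C" "(u, u') \<in> S" "(v, v') \<in> S" for S u u' v v'
    using that by (simp add: monoid_congruence_def)
  have "refl (\<Inter> ?C)"
    using eq(1) by (meson InterI UNIV_I refl_onD refl_onI)
  moreover have "sym (\<Inter> ?C)"
    using eq(2) by (meson InterD InterI symD symI)
  moreover have "trans (\<Inter> ?C)"
    using eq(3) by (meson InterD InterI transD transI)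
  moreover have "(u @ v, u' @ v') \<in> \<Inter> ?C"
    if "(u, u') \<in> \<Inter> ?C" "(v, v') \<in> \<Inter> ?C" for u u' v v'
    using app that by (meson InterD InterI)
  ultimately show ?thesis
    unfolding monoid_congruence_def generated_congruence_def equiv_def by simp
qed

text \<open>
  The product of two classes is written as a union over all representatives; if \<open>R\<close> is a
  congruence, every member of the union is the same class.
\<close>

definition word_quotient :: "('a list \<times> 'a list) set \<Rightarrow> 'a list set monoid" where
  "word_quotient R =
     \<lparr>carrier = UNIV // R, mult = (\<lambda>A B. \<Union>u\<in>A. \<Union>v\<in>B. R `` {u @ v}), one = R `` {[]}\<rparr>"

lemma word_quotient_mult:
  assumes "monoid_congruence R"
  shows "R `` {u} \<otimes>\<^bsub>word_quotient R\<^esub> R `` {v} = R `` {u @ v}"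
proof -
  have eq: "equiv UNIV R"
    and app: "\<And>u u' v v'. (u, u') \<in> R \<Longrightarrow> (v, v') \<in> R \<Longrightarrow> (u @ v, u' @ v') \<in> R"
    using assms by (auto simp: monoid_congruence_def)
  have "R `` {u' @ v'} = R `` {u @ v}" if "u' \<in> R `` {u}" "v' \<in> R `` {v}" for u' v'
    using equiv_class_eq[OF eq app] that by (metis Image_singleton_iff)
  moreover have "u \<in> R `` {u}" "v \<in> R `` {v}"
    using eq by (auto simp: equiv_def refl_on_def)
  ultimately have "(\<Union>u'\<in>R `` {u}. \<Union>v'\<in>R `` {v}. R `` {u' @ v'}) = R `` {u @ v}"
    by blast
  then show ?thesis
    by (simp add: word_quotient_def)
qed

lemma monoid_word_quotient:
  assumes "monoid_congruence R"
  shows "monoid (word_quotient R)"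
proof -
  have one: "\<one>\<^bsub>word_quotient R\<^esub> = R `` {[]}"
    and carr: "carrier (word_quotient R) = UNIV // R"
    by (simp_all add: word_quotient_def)
  show ?thesis
    by (rule monoidI)
      (auto simp: carr one word_quotient_mult[OF assms] elim!: quotientE intro!: quotientI)
qed

definition monoid_presentation :: "('a list \<times> 'a list) set \<Rightarrow> 'a list set monoid" where
  "monoid_presentation R = word_quotient (generated_congruence R)"

definition thompson_relations :: "(nat list \<times> nat list) set" where
  "thompson_relations = {([i, j], [j + 1, i]) | i j. i < j}"

definition thompson_monoid :: "nat list set monoid" where
  "thompson_monoid = monoid_presentation thompson_relations"

text \<open>
  A forest is the sequence of its trees, so the root labels are the indices. The leaf labels
  \<open>0, 1, 2, \<dots>\<close> are determined by the left-to-right order of the leaves and are therefore not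
  stored. The values at the nodes are the labels of the interior vertices; \<open>unit\<close> is used when
  there are none.
\<close>

type_synonym 'a forest = "nat \<Rightarrow> 'a tree"

fun decreasing :: "nat tree \<Rightarrow> bool" where
  "decreasing \<langle>\<rangle> = True"
| "decreasing \<langle>l, a, r\<rangle> \<longleftrightarrow>
     (\<forall>b \<in> set_tree l \<union> set_tree r. b < a) \<and> decreasing l \<and> decreasing r"

text \<open>
  The first two conditions on labels say that no label is used twice, inside one tree or in two
  different trees.
\<close>

definition linearized_forest :: "nat \<Rightarrow> nat forest \<Rightarrow> bool" where
  "linearized_forest n f \<longleftrightarrow>
     finite {k. f k \<noteq> \<langle>\<rangle>} \<and>
     (\<forall>k. distinct (inorder (f k))) \<and>
     (\<forall>k l. k \<noteq> l \<longrightarrow> set_tree (f k) \<inter> set_tree (f l) = {}) \<and>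
     (\<Union>k. set_tree (f k)) = {1..n} \<and>
     (\<forall>k. decreasing (f k))"

definition linearized_forests :: "nat forest set" where
  "linearized_forests = {f. \<exists>n. linearized_forest n f}"

definition add_caret :: "nat \<Rightarrow> nat \<Rightarrow> nat forest \<Rightarrow> nat forest" where
  "add_caret a i f =
     (\<lambda>k. if k < i then f k else if k = i then \<langle>f i, a, f (i + 1)\<rangle> else f (k + 1))"

text \<open>The word is read from left to right, and its \<open>j\<close>-th letter, counted from 1, adds caret \<open>j\<close>.\<close>

definition tau :: "nat list \<Rightarrow> nat forest" where
  "tau w = fold (\<lambda>(j, i). add_caret j i) (enumerate 1 w) (\<lambda>_. \<langle>\<rangle>)"

definition forget_labels :: "'a forest \<Rightarrow> unit forest" where
  "forget_labels f = (\<lambda>k. map_tree (\<lambda>_. ()) (f k))"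

definition forest_congruence :: "(nat list \<times> nat list) set" where
  "forest_congruence = {(u, v). forget_labels (tau u) = forget_labels (tau v)}"

lemma tau_Nil [simp]: "tau [] = (\<lambda>_. \<langle>\<rangle>)"
  by (simp add: tau_def)

lemma tau_snoc [simp]: "tau (w @ [i]) = add_caret (length w + 1) i (tau w)"
  by (simp add: tau_def enumerate_append_eq)

lemma add_caret_skip:
  "add_caret a i f k = f (if k < i then k else k + 1)" if "k \<noteq> i"
  using that by (simp add: add_caret_def)

lemma add_caret_same: "add_caret a i f i = \<langle>f i, a, f (i + 1)\<rangle>"
  by (simp add: add_caret_def)

lemma linearized_forest_add_caret:
  assumes "linearized_forest n f"
  shows "linearized_forest (Suc n) (add_caret (Suc n) i f)"
proof -
  let ?g = "add_caret (Suc n) i f"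
  note f = assms[unfolded linearized_forest_def]
  have fin: "finite {k. f k \<noteq> \<langle>\<rangle>}" and dist: "\<And>k. distinct (inorder (f k))"
    and disj: "\<And>k l. k \<noteq> l \<Longrightarrow> set_tree (f k) \<inter> set_tree (f l) = {}"
    and lab: "(\<Union>k. set_tree (f k)) = {1..n}" and dec: "\<And>k. decreasing (f k)"
    using f by auto
  have le: "a \<le> n" if "a \<in> set_tree (f k)" for a k
    using lab that by force
  have "{k. ?g k \<noteq> \<langle>\<rangle>} \<subseteq> insert i ({k. f k \<noteq> \<langle>\<rangle>} \<union> (\<lambda>k. k - 1) ` {k. f k \<noteq> \<langle>\<rangle>})"
    by (force simp: add_caret_def image_iff split: if_splits)
  then have 1: "finite {k. ?g k \<noteq> \<langle>\<rangle>}"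
    by (rule finite_subset) (use fin in auto)
  have 2: "distinct (inorder (?g k))" for k
    using dist disj[of i "i + 1"] le by (force simp: add_caret_def)
  have 3: "set_tree (?g k) \<inter> set_tree (?g l) = {}" if "k \<noteq> l" for k l
  proof -
    define p where "p m = (if m \<le> i then m else m - 1)" for m
    have g: "x = Suc n \<and> k = i \<or> (\<exists>m. x \<in> set_tree (f m) \<and> p m = k)"
      if "x \<in> set_tree (?g k)" for x k
    proof (cases "k = i")
      case True
      then show ?thesis
        using that by (auto simp: add_caret_same p_def intro: exI[of _ i] exI[of _ "Suc i"])
    next
      case False
      then have "p (if k < i then k else k + 1) = k" by (auto simp: p_def)
      then show ?thesis using that unfolding add_caret_skip[OF False] by blast
    qed
    have False if x: "x \<in> set_tree (?g k)" "x \<in> set_tree (?g l)" for x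
    proof (cases "x = Suc n")
      case True
      then show ?thesis using g[OF x(1)] g[OF x(2)] le[of "Suc n"] \<open>k \<noteq> l\<close> by auto
    next
      case False
      then obtain m m' where "x \<in> set_tree (f m)" "p m = k" "x \<in> set_tree (f m')" "p m' = l"
        using g[OF x(1)] g[OF x(2)] by blast
      then show ?thesis using disj[of m m'] \<open>k \<noteq> l\<close> by blast
    qed
    then show ?thesis by blast
  qed
  have sub: "\<exists>l. set_tree (f k) \<subseteq> set_tree (?g l)" for k
    by (rule exI[of _ "if k \<le> i then k else k - 1"]) (auto simp: add_caret_def)
  have "(\<Union>k. set_tree (?g k)) = insert (Suc n) (\<Union>k. set_tree (f k))"
  proof (intro equalityI)
    show "(\<Union>k. set_tree (?g k)) \<subseteq> insert (Suc n) (\<Union>k. set_tree (f k))"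
      by (auto simp: add_caret_def split: if_splits)
    have "Suc n \<in> set_tree (?g i)"
      by (simp add: add_caret_def)
    then show "insert (Suc n) (\<Union>k. set_tree (f k)) \<subseteq> (\<Union>k. set_tree (?g k))"
      using sub by blast
  qed
  then have 4: "(\<Union>k. set_tree (?g k)) = {1..Suc n}"
    using lab by auto
  have 5: "decreasing (?g k)" for k
    using dec le by (auto simp: add_caret_def less_Suc_eq_le)
  show ?thesis
    unfolding linearized_forest_def using 1 2 3 4 5 by blast
qed

lemma linearized_forest_tau: "linearized_forest (length w) (tau w)"
proof (induction w rule: rev_induct)
  case Nil
  then show ?case by (simp add: linearized_forest_def)
next
  case (snoc i w)
  then show ?case using linearized_forest_add_caret by simp
qed

lemma linearized_forest_unique:
  assumes "linearized_forest m f" "linearized_forest n f"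
  shows "m = n"
proof -
  have "{1..m} = {1..n}"
    using assms by (simp add: linearized_forest_def)
  then show ?thesis by (metis card_atLeastAtMost diff_Suc_1)
qed

lemma linearized_forest_0:
  assumes "linearized_forest 0 f"
  shows "f = (\<lambda>_. \<langle>\<rangle>)"
proof
  fix k
  have "set_tree (f k) = {}"
    using assms by (simp add: linearized_forest_def)
  then show "f k = \<langle>\<rangle>" by simp
qed

lemma linearized_forest_SucE:
  assumes "linearized_forest (Suc n) f"
  obtains i g where "linearized_forest n g" "f = add_caret (Suc n) i g"
proof -
  note f = assms[unfolded linearized_forest_def]
  have fin: "finite {k. f k \<noteq> \<langle>\<rangle>}" and dist: "\<And>k. distinct (inorder (f k))"
    and disj: "\<And>k l. k \<noteq> l \<Longrightarrow> set_tree (f k) \<inter> set_tree (f l) = {}"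
    and lab: "(\<Union>k. set_tree (f k)) = {1..Suc n}" and dec: "\<And>k. decreasing (f k)"
    using f by auto
  have "Suc n \<in> (\<Union>k. set_tree (f k))"
    using lab by simp
  then obtain i where i: "Suc n \<in> set_tree (f i)"
    by blast
  then obtain l a r where lr: "f i = \<langle>l, a, r\<rangle>"
    by (cases "f i") auto
  have "a \<le> Suc n"
    using lab lr by (metis UNIV_I UN_I atLeastAtMost_iff tree.set_intros(2))
  moreover have lt: "\<forall>b \<in> set_tree l \<union> set_tree r. b < a"
    using dec[of i] by (simp add: lr)
  moreover have "Suc n = a \<or> Suc n \<in> set_tree l \<union> set_tree r"
    using i by (auto simp: lr)
  ultimately have a: "a = Suc n"
    by (metis leD)
  define g where "g k = (if k < i then f k else if k = i then l else if k = Suc i then r else f (k - 1))" for k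
  have fg: "f = add_caret (Suc n) i g"
    by (rule ext) (simp add: g_def add_caret_def lr a)
  have neq: "Suc n \<notin> set_tree (f k)" if "k \<noteq> i" for k
    using disj[OF that] i by blast
  have il: "set_tree l \<inter> set_tree r = {}"
    using dist[of i] by (auto simp: lr)
  have nl: "Suc n \<notin> set_tree l" "Suc n \<notin> set_tree r"
    using lt a by auto
  have "{k. g k \<noteq> \<langle>\<rangle>} \<subseteq> {i, Suc i} \<union> {k. f k \<noteq> \<langle>\<rangle>} \<union> Suc ` {k. f k \<noteq> \<langle>\<rangle>}"
  proof
    fix k assume "k \<in> {k. g k \<noteq> \<langle>\<rangle>}"
    then show "k \<in> {i, Suc i} \<union> {k. f k \<noteq> \<langle>\<rangle>} \<union> Suc ` {k. f k \<noteq> \<langle>\<rangle>}"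
      by (cases k) (auto simp: g_def split: if_splits)
  qed
  then have 1: "finite {k. g k \<noteq> \<langle>\<rangle>}"
    by (rule finite_subset) (use fin in auto)
  have 2: "distinct (inorder (g k))" for k
    using dist dist[of i] by (auto simp: g_def lr)
  define p where "p k = (if k \<le> i then k else k - 1)" for k
  have gp: "set_tree (g k) \<subseteq> set_tree (f (p k)) - {Suc n}" for k
    using neq nl by (auto simp: g_def p_def lr)
  have 3: "set_tree (g k) \<inter> set_tree (g m) = {}" if "k \<noteq> m" for k m
  proof (cases "p k = p m")
    case True
    then have "k = i \<and> m = Suc i \<or> k = Suc i \<and> m = i"
      using that by (auto simp: p_def split: if_splits)
    then show ?thesis using il by (auto simp: g_def)
  next
    case False
    then show ?thesis using gp[of k] gp[of m] disj[OF False] by blast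
  qed
  have sub: "set_tree (f k) - {Suc n} \<subseteq> (\<Union>k. set_tree (g k))" for k
  proof -
    have "set_tree (f k) \<subseteq> insert (Suc n) (\<Union>k. set_tree (g k))"
      unfolding fg by (auto simp: add_caret_def split: if_splits)
    then show ?thesis by blast
  qed
  have "(\<Union>k. set_tree (g k)) = (\<Union>k. set_tree (f k)) - {Suc n}"
    using sub gp by blast
  then have 4: "(\<Union>k. set_tree (g k)) = {1..n}"
    using lab by auto
  have 5: "decreasing (g k)" for k
    using dec dec[of i] by (auto simp: g_def lr)
  have "linearized_forest n g"
    unfolding linearized_forest_def using 1 2 3 4 5 by blast
  then show ?thesis using fg that by blast
qed

lemma add_caret_inject:
  assumes f: "linearized_forest n f" and g: "linearized_forest n g"
    and eq: "add_caret (Suc n) i f = add_caret (Suc n) j g"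
  shows "i = j \<and> f = g"
proof -
  have "Suc n \<in> set_tree (add_caret (Suc n) i f i)" "Suc n \<in> set_tree (add_caret (Suc n) i f j)"
    unfolding add_caret_same eq by (simp_all add: add_caret_same flip: eq)
  then have ij: "i = j"
    using linearized_forest_add_caret[OF f, of i] unfolding linearized_forest_def by blast
  have "f k = g k" for k
  proof -
    consider "k < i" | "k = i" | "k = Suc i" | "k > Suc i" by linarith
    then show ?thesis
    proof cases
      case 4
      then obtain m where "k = Suc m" "m > i" by (cases k) auto
      then show ?thesis using fun_cong[OF eq, of m] ij by (simp add: add_caret_def)
    qed (use fun_cong[OF eq, of k] fun_cong[OF eq, of i] ij in \<open>auto simp: add_caret_def\<close>)
  qed
  with ij show ?thesis by blast
qed

lemma bij_betw_tau: "bij_betw tau UNIV linearized_forests"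
proof (rule bij_betw_imageI)
  have "tau u = tau v \<Longrightarrow> u = v" for u v
  proof (induction u arbitrary: v rule: rev_induct)
    case Nil
    then have "length v = 0"
      using linearized_forest_tau[of v] linearized_forest_tau[of "[]"]
      by (metis linearized_forest_unique list.size(3))
    then show ?case by simp
  next
    case (snoc i u)
    then have len: "length v = Suc (length u)"
      using linearized_forest_tau[of v] linearized_forest_tau[of "u @ [i]"]
      by (metis linearized_forest_unique length_append_singleton)
    then obtain v' j where v: "v = v' @ [j]"
      by (metis length_Suc_conv_rev)
    have "i = j \<and> tau u = tau v'"
      using snoc.prems len linearized_forest_tau[of u] linearized_forest_tau[of v']
      by (intro add_caret_inject[where n = "length u"]) (auto simp: v)
    with snoc.IH v show ?case by blast
  qed
  then show "inj_on tau UNIV" by (auto intro: injI)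
  have "f \<in> range tau" if "linearized_forest n f" for n f
    using that
  proof (induction n arbitrary: f)
    case 0
    then have "f = tau []" using linearized_forest_0[of f] by simp
    then show ?case by blast
  next
    case (Suc n)
    then obtain i g where g: "linearized_forest n g" and f: "f = add_caret (Suc n) i g"
      using linearized_forest_SucE by blast
    obtain w where w: "g = tau w" using Suc.IH[OF g] by blast
    have "length w = n"
      using linearized_forest_unique[OF linearized_forest_tau[of w]] g w by blast
    then have "f = tau (w @ [i])" by (simp add: f w)
    then show ?case by (rule range_eqI)
  qed
  moreover have "tau w \<in> linearized_forests" for w
    using linearized_forest_tau unfolding linearized_forests_def by blast
  ultimately show "range tau = linearized_forests"
    unfolding linearized_forests_def by blast
qed

end

theory Submission
  imports Defs
begin

text \<open>
  Without its labels a linearized forest only remembers which carets sit below which, and the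
  letters of a word act on such shapes one after the other, \<open>x\<^sub>i\<close> by joining the roots \<open>i\<close> and
  \<open>i + 1\<close>. The defining relations of Thompson's monoid hold for this action on every forest, not
  just on the trivial one: two carets over disjoint pairs of neighbouring roots may be added in
  either order, and if the left one is added first, the roots to its right lose 1 in their label
  (\<open>add_shapes_generated\<close>). Hence the generated congruence is contained in the forest congruence.

  Conversely, if the tree with root \<open>i\<close> in the forest of \<open>v\<close> is nontrivial, its top caret can be
  added last: all letters of \<open>v\<close> that come after the one adding this caret act on other roots, and
  the relations move the caret to the right past each of them, so that \<open>v\<close> is congruent to
  \<open>v' @ [i]\<close> for some word \<open>v'\<close> (\<open>generated_snoc_of_nontrivial_root\<close>). If \<open>u @ [i]\<close> and \<open>v\<close> have
  the same shape, the tree at \<open>i\<close> is nontrivial; rewriting \<open>v\<close> in this way and removing the top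
  caret leaves the shorter word \<open>u\<close> and the word \<open>v'\<close>, again with the same shape, and induction
  on \<open>u\<close> finishes the proof.
\<close>

lemma generated_congruence_incl: "R \<subseteq> generated_congruence R"
  by (auto simp: generated_congruence_def)

lemma generated_congruence_least:
  "monoid_congruence S \<Longrightarrow> R \<subseteq> S \<Longrightarrow> generated_congruence R \<subseteq> S"
  by (auto simp: generated_congruence_def)

lemma generated_congruence_refl: "(u, u) \<in> generated_congruence R"
  using monoid_congruence_generated_congruence[of R]
  by (auto simp: monoid_congruence_def equiv_def refl_on_def)

lemma generated_congruence_sym:
  "(u, v) \<in> generated_congruence R \<Longrightarrow> (v, u) \<in> generated_congruence R"
  using monoid_congruence_generated_congruence[of R]
  by (auto simp: monoid_congruence_def equiv_def dest: symD)

lemma generated_congruence_trans: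
  "(u, v) \<in> generated_congruence R \<Longrightarrow> (v, w) \<in> generated_congruence R \<Longrightarrow>
    (u, w) \<in> generated_congruence R"
  using monoid_congruence_generated_congruence[of R]
  by (auto simp: monoid_congruence_def equiv_def dest: transD)

lemma generated_congruence_append:
  "(u, u') \<in> generated_congruence R \<Longrightarrow> (v, v') \<in> generated_congruence R \<Longrightarrow>
    (u @ v, u' @ v') \<in> generated_congruence R"
  using monoid_congruence_generated_congruence[of R]
  by (auto simp: monoid_congruence_def)

lemma thompson_relation:
  "i < j \<Longrightarrow> ([i, j], [Suc j, i]) \<in> generated_congruence thompson_relations"
  using generated_congruence_incl[of thompson_relations] by (auto simp: thompson_relations_def)

text \<open>
  Without labels the effect of a letter does not depend on its position in the word, so that words
  act on forest shapes from the right.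
\<close>

definition add_shape :: "nat \<Rightarrow> unit forest \<Rightarrow> unit forest" where
  "add_shape i f =
     (\<lambda>k. if k < i then f k else if k = i then \<langle>f i, (), f (i + 1)\<rangle> else f (k + 1))"

abbreviation add_shapes :: "nat list \<Rightarrow> unit forest \<Rightarrow> unit forest" where
  "add_shapes \<equiv> fold add_shape"

lemma forget_labels_add_caret:
  "forget_labels (add_caret a i f) = add_shape i (forget_labels f)"
  by (rule ext) (simp add: forget_labels_def add_caret_def add_shape_def)

lemma forget_labels_tau: "forget_labels (tau w) = add_shapes w (\<lambda>_. \<langle>\<rangle>)"
proof (induction w rule: rev_induct)
  case Nil
  then show ?case by (simp add: forget_labels_def)
next
  case (snoc i w)
  then show ?case by (simp add: forget_labels_add_caret)
qed

lemma add_shape_same: "add_shape i f i = \<langle>f i, (), f (i + 1)\<rangle>"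
  by (simp add: add_shape_def)

lemma add_shape_skip: "k \<noteq> i \<Longrightarrow> add_shape i f k = f (if k < i then k else Suc k)"
  by (simp add: add_shape_def)

lemma add_shape_commute:
  assumes "i < j"
  shows "add_shape j (add_shape i f) = add_shape i (add_shape (Suc j) f)"
  by (rule ext) (use assms in \<open>auto simp: add_shape_def\<close>)

lemma inj_add_shape: "inj (add_shape i)"
proof (rule injI, rule ext)
  fix f g k assume eq: "add_shape i f = add_shape i g"
  have at: "add_shape i f m = add_shape i g m" for m
    by (simp add: eq)
  consider "k < i" | "k = i" | "k = Suc i" | "k > Suc i"
    by linarith
  then show "f k = g k"
  proof cases
    case 1
    then show ?thesis using at[of k] by (simp add: add_shape_skip)
  next
    case 4
    then show ?thesis using at[of "k - 1"] by (simp add: add_shape_skip split: if_splits)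
  qed (use at[of i] in \<open>simp_all add: add_shape_same\<close>)
qed

text \<open>
  Words that act in the same way on all forests are related by a monoid congruence, because the
  action of a product is the composition of the actions. Acting in the same way on the trivial
  forest alone is not visibly a congruence: multiplying on the left by \<open>w\<close> replaces the trivial
  forest by that of \<open>w\<close>.
\<close>

lemma add_shapes_generated:
  assumes "(u, v) \<in> generated_congruence thompson_relations"
  shows "add_shapes u f = add_shapes v f"
proof -
  let ?S = "{(u, v). add_shapes u = add_shapes v}"
  have "monoid_congruence ?S"
    unfolding monoid_congruence_def equiv_def by (auto intro: refl_onI symI transI)
  moreover have "thompson_relations \<subseteq> ?S"
    by (auto simp: thompson_relations_def comp_def add_shape_commute)
  ultimately have "(u, v) \<in> ?S"
    using generated_congruence_least assms by blast
  then show ?thesis by simp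
qed

text \<open>
  A caret that is the root of its tree at the end has not been used by any later letter, and a
  defining relation, read in one direction or the other, moves it past each later letter \<open>j\<close>. Its
  index is \<open>i\<close> at the end of the word, and it was \<open>i + 1\<close> before a letter \<open>j < i\<close>.
\<close>

lemma generated_snoc_of_nontrivial_root:
  assumes "add_shapes v (\<lambda>_. \<langle>\<rangle>) i \<noteq> \<langle>\<rangle>"
  shows "\<exists>v'. (v, v' @ [i]) \<in> generated_congruence thompson_relations"
  using assms
proof (induction v arbitrary: i rule: rev_induct)
  case Nil
  then show ?case by simp
next
  case (snoc j v)
  let ?G = "generated_congruence thompson_relations"
  have step: "(v @ [j], w @ [b, i]) \<in> ?G"
    if "(v, w @ [a]) \<in> ?G" "([a, j], [b, i]) \<in> ?G" for w a b
  proof -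
    have "(v @ [j], w @ [a, j]) \<in> ?G"
      using generated_congruence_append[OF that(1) generated_congruence_refl[of "[j]"]] by simp
    moreover have "(w @ [a, j], w @ [b, i]) \<in> ?G"
      by (rule generated_congruence_append[OF generated_congruence_refl that(2)])
    ultimately show ?thesis by (rule generated_congruence_trans)
  qed
  consider "j = i" | "i < j" | "j < i" by linarith
  then show ?case
  proof cases
    case 1
    then show ?thesis using generated_congruence_refl by blast
  next
    case 2
    then have "add_shapes v (\<lambda>_. \<langle>\<rangle>) i \<noteq> \<langle>\<rangle>"
      using snoc.prems by (simp add: add_shape_skip)
    then obtain w where "(v, w @ [i]) \<in> ?G" using snoc.IH by blast
    then have "(v @ [j], (w @ [Suc j]) @ [i]) \<in> ?G"
      using step thompson_relation[OF 2] by simp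
    then show ?thesis by blast
  next
    case 3
    then have "add_shapes v (\<lambda>_. \<langle>\<rangle>) (Suc i) \<noteq> \<langle>\<rangle>"
      using snoc.prems by (simp add: add_shape_skip)
    then obtain w where "(v, w @ [Suc i]) \<in> ?G" using snoc.IH by blast
    then have "(v @ [j], (w @ [j]) @ [i]) \<in> ?G"
      using step generated_congruence_sym[OF thompson_relation[OF 3]] by simp
    then show ?thesis by blast
  qed
qed

lemma generated_of_add_shapes_eq:
  assumes "add_shapes u (\<lambda>_. \<langle>\<rangle>) = add_shapes v (\<lambda>_. \<langle>\<rangle>)"
  shows "(u, v) \<in> generated_congruence thompson_relations"
  using assms
proof (induction u arbitrary: v rule: rev_induct)
  case Nil
  have "v = []"
  proof (cases v rule: rev_cases)
    case (snoc w j)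
    (* The last letter of a nonempty word leaves a caret at its own index. *)
    then show ?thesis
      using fun_cong[OF Nil.prems, of j] by (simp add: add_shape_same)
  qed simp
  then show ?case by (simp add: generated_congruence_refl)
next
  case (snoc i u)
  let ?G = "generated_congruence thompson_relations"
  have "add_shapes v (\<lambda>_. \<langle>\<rangle>) i \<noteq> \<langle>\<rangle>"
    unfolding snoc.prems[symmetric] by (simp add: add_shape_same)
  then obtain w where w: "(v, w @ [i]) \<in> ?G"
    using generated_snoc_of_nontrivial_root by blast
  have "add_shapes (u @ [i]) (\<lambda>_. \<langle>\<rangle>) = add_shapes (w @ [i]) (\<lambda>_. \<langle>\<rangle>)"
    using snoc.prems add_shapes_generated[OF w] by simp
  then have "add_shapes u (\<lambda>_. \<langle>\<rangle>) = add_shapes w (\<lambda>_. \<langle>\<rangle>)"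
    by (simp add: inj_eq[OF inj_add_shape])
  then have "(u @ [i], w @ [i]) \<in> ?G"
    by (intro generated_congruence_append snoc.IH generated_congruence_refl)
  then show ?case
    using generated_congruence_sym[OF w] by (rule generated_congruence_trans)
qed

theorem theorem2:
  "forest_congruence = generated_congruence thompson_relations \<and>
   word_quotient forest_congruence = thompson_monoid"
proof -
  have "forest_congruence = generated_congruence thompson_relations"
    by (auto simp: forest_congruence_def forget_labels_tau
        intro: generated_of_add_shapes_eq dest: add_shapes_generated)
  then show ?thesis
    by (simp add: thompson_monoid_def monoid_presentation_def)
qed

end
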